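(* Let $(X,d)$ be a noncompact proper metric space. Then the sublinear Higson corona $\nu_L X$ is not locally connected at any point.
   Context: A metric space $(X,d)$ is proper if every closed ball $\{y\in X : d(x,y)\le r\}$, $x\in X$, $r>0$, is compact. Fix a base point $x_0\in X$ and write $|x|=d(x,x_0)$; $B_d(x,r)=\{y\in X : d(x,y)<r\}$. A (not necessarily continuous) function $s:\mathbb{R}_+\to\mathbb{R}_+$ on the set of positive real numbers is asymptotically sublinear if for every $\alpha>0$ there is $t_0>0$ such that $s(t)<\alpha t$ for all $t>t_0$. Let $\mathcal{L}$ be the set of all asymptotically sublinear functions. Let $C^*(X)$ be the ring of bounded continuous real-valued functions on $X$, and let $C_L(X)$ be the set of all $f\in C^*(X)$ such that for every $s\in\mathcal{L}$, $\lim_{|x|\to\infty}\operatorname{diam} f(B_d(x,s(|x|)))=0$, i.e. for every $s\in\mathcal L$ and $\varepsilon>0$ there is $r_0>0$ such that $\operatorname{diam} f(B_d(x,s(|x|)))<\varepsilon$ for all $x\in X$ with $|x|>r_0$. $C_L(X)$ is a closed subring of $C^*(X)$ which contains the constants and generates the topology of $X$. The sublinear Higson compactification $h_L X$ is the unique (Hausdorff) compactification of $X$ associated with $C_L(X)$; it is characterized by: a bounded continuous $f:X\to\mathbb{R}$ extends continuously to $h_L X$ if and only if $f\in C_L(X)$. The sublinear Higson corona is $\nu_L X=h_L X\setminus X$ with the subspace topology. A topological space $Z$ is locally connected at $p\in Z$ if each neighborhood of $p$ contains a connected open neighborhood of $p$. *)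

theory Defs
  imports "HOL-Analysis.Analysis"
begin

text \<open>
  The metric space $X$ is the whole of a type of class \<^class>\<open>metric_space\<close>.
\<close>

definition proper_metric :: "'a::metric_space itself \<Rightarrow> bool" where
  "proper_metric _ \<longleftrightarrow> (\<forall>(x::'a) r. r > 0 \<longrightarrow> compact (cball x r))"

text \<open>
  Functions from the positive reals to the positive reals are represented by total functions
  on the reals; values at nonpositive arguments are unconstrained.
\<close>

definition asymptotically_sublinear :: "(real \<Rightarrow> real) \<Rightarrow> bool" where
  "asymptotically_sublinear s \<longleftrightarrow>
     (\<forall>t>0. s t > 0) \<and> (\<forall>\<alpha>>0. \<exists>t0>0. \<forall>t>t0. s t < \<alpha> * t)"

text \<open>
  Since the radius threshold \<open>r0\<close> is positive, \<open>s\<close> is only evaluated at positive arguments.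
\<close>

definition C_L :: "'a::metric_space \<Rightarrow> ('a \<Rightarrow> real) set" where
  "C_L x0 = {f \<in> bcontfun. \<forall>s. asymptotically_sublinear s \<longrightarrow>
     (\<forall>\<epsilon>>0. \<exists>r0>0. \<forall>x. dist x x0 > r0 \<longrightarrow>
        diameter (f ` ball x (s (dist x x0))) < \<epsilon>)}"

definition compactification :: "'b topology \<Rightarrow> ('a::topological_space \<Rightarrow> 'b) \<Rightarrow> bool" where
  "compactification K e \<longleftrightarrow>
     compact_space K \<and> Hausdorff_space K \<and>
     embedding_map euclidean K e \<and> K closure_of (range e) = topspace K"

definition extends_continuously :: "'b topology \<Rightarrow> ('a \<Rightarrow> 'b) \<Rightarrow> ('a \<Rightarrow> real) \<Rightarrow> bool" where
  "extends_continuously K e f \<longleftrightarrow>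
     (\<exists>F. continuous_map K euclideanreal F \<and> (\<forall>x. F (e x) = f x))"

text \<open>
  The sublinear Higson compactification is only determined up to equivalence of
  compactifications, so it is introduced as a predicate on pairs \<open>(K, e)\<close>. A concrete pair
  satisfying it is constructed in \<open>sublinear_Higson_compactification_exists\<close> below.
\<close>

definition sublinear_Higson_compactification ::
    "'a::metric_space \<Rightarrow> 'b topology \<Rightarrow> ('a \<Rightarrow> 'b) \<Rightarrow> bool" where
  "sublinear_Higson_compactification x0 K e \<longleftrightarrow>
     compactification K e \<and>
     (\<forall>f\<in>bcontfun. extends_continuously K e f \<longleftrightarrow> f \<in> C_L x0)"

definition corona :: "'b topology \<Rightarrow> ('a \<Rightarrow> 'b) \<Rightarrow> 'b topology" where
  "corona K e = subtopology K (topspace K - range e)"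


subsection \<open>Existence of the sublinear Higson compactification\<close>

lemma C_L_oscillation:
  fixes x0 :: "'a::metric_space"
  assumes f: "f \<in> C_L x0" and s: "asymptotically_sublinear s" and "\<epsilon> > 0"
  shows "\<exists>r0>0. \<forall>x y z. dist x x0 > r0 \<longrightarrow> y \<in> ball x (s (dist x x0)) \<longrightarrow>
           z \<in> ball x (s (dist x x0)) \<longrightarrow> \<bar>f y - f z\<bar> < \<epsilon>"
proof -
  have "\<exists>r0>0. \<forall>x. dist x x0 > r0 \<longrightarrow> diameter (f ` ball x (s (dist x x0))) < \<epsilon>"
    using assms by (simp add: C_L_def)
  then obtain r0 where "r0 > 0"
    and r0: "\<forall>x. dist x x0 > r0 \<longrightarrow> diameter (f ` ball x (s (dist x x0))) < \<epsilon>"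
    by (elim exE conjE)
  have "bounded (range f)" using f by (simp add: C_L_def bcontfun_def)
  then have bd: "bounded (f ` S)" for S
    by (rule bounded_subset) blast
  have "\<bar>f y - f z\<bar> < \<epsilon>" if "dist x x0 > r0" "y \<in> ball x (s (dist x x0))"
    "z \<in> ball x (s (dist x x0))" for x y z
  proof -
    have "dist (f y) (f z) \<le> diameter (f ` ball x (s (dist x x0)))"
      by (intro diameter_bounded_bound bd imageI that)
    also have "\<dots> < \<epsilon>" using r0 that(1) by simp
    finally show ?thesis by (simp add: dist_real_def)
  qed
  with \<open>r0 > 0\<close> show ?thesis by (intro exI[of _ r0]) simp
qed

lemma C_L_I:
  fixes x0 :: "'a::metric_space"
  assumes f: "f \<in> bcontfun"
    and osc: "\<And>s \<epsilon>. \<lbrakk>asymptotically_sublinear s; \<epsilon> > 0\<rbrakk> \<Longrightarrow>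
      \<exists>r0>0. \<forall>x y z. dist x x0 > r0 \<longrightarrow> y \<in> ball x (s (dist x x0)) \<longrightarrow>
           z \<in> ball x (s (dist x x0)) \<longrightarrow> \<bar>f y - f z\<bar> < \<epsilon>"
  shows "f \<in> C_L x0"
proof -
  have "\<exists>r0>0. \<forall>x. dist x x0 > r0 \<longrightarrow> diameter (f ` ball x (s (dist x x0))) < \<epsilon>"
    if s: "asymptotically_sublinear s" and "\<epsilon> > 0" for s and \<epsilon> :: real
  proof -
    have "\<epsilon>/2 > 0" using \<open>\<epsilon> > 0\<close> by simp
    from osc[OF s this] obtain r0 where "r0 > 0"
      and r0: "\<forall>x y z. dist x x0 > r0 \<longrightarrow> y \<in> ball x (s (dist x x0)) \<longrightarrow>
           z \<in> ball x (s (dist x x0)) \<longrightarrow> \<bar>f y - f z\<bar> < \<epsilon>/2"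
      by (elim exE conjE)
    have "diameter (f ` ball x (s (dist x x0))) < \<epsilon>" if "dist x x0 > r0" for x
    proof -
      have "diameter (f ` ball x (s (dist x x0))) \<le> \<epsilon>/2"
      proof (rule diameter_le)
        show "f ` ball x (s (dist x x0)) \<noteq> {} \<or> 0 \<le> \<epsilon>/2" using \<open>\<epsilon> > 0\<close> by simp
        fix u v assume "u \<in> f ` ball x (s (dist x x0))" "v \<in> f ` ball x (s (dist x x0))"
        then obtain y z where "u = f y" "v = f z" "y \<in> ball x (s (dist x x0))" "z \<in> ball x (s (dist x x0))"
          by (elim imageE)
        then show "norm (u - v) \<le> \<epsilon>/2" using r0 that by (simp add: less_imp_le)
      qed
      with \<open>\<epsilon> > 0\<close> show ?thesis by simp
    qed
    with \<open>r0 > 0\<close> show ?thesis by (intro exI[of _ r0]) simp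
  qed
  with f show ?thesis by (simp add: C_L_def)
qed

lemma C_L_bcontfun: "f \<in> C_L x0 \<Longrightarrow> f \<in> bcontfun"
  by (simp add: C_L_def)

lemma bcontfun_bound:
  fixes f :: "'a::metric_space \<Rightarrow> real"
  assumes "f \<in> bcontfun"
  obtains B where "B > 0" "\<And>x. \<bar>f x\<bar> \<le> B"
  using assms unfolding bcontfun_def bounded_pos by auto

lemma bcontfunI_real:
  fixes f :: "'a::metric_space \<Rightarrow> real"
  assumes "continuous_on UNIV f" "\<And>x. \<bar>f x\<bar> \<le> B"
  shows "f \<in> bcontfun"
  using assms unfolding bcontfun_def bounded_iff by auto

lemma C_L_control:
  fixes x0 :: "'a::metric_space"
  assumes h: "h \<in> bcontfun"
    and ctl: "\<And>\<epsilon>. \<epsilon> > 0 \<Longrightarrow> \<exists>G \<delta>. finite G \<and> G \<subseteq> C_L x0 \<and> \<delta> > 0 \<and>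
       (\<forall>y z. (\<forall>g\<in>G. \<bar>g y - g z\<bar> < \<delta>) \<longrightarrow> \<bar>h y - h z\<bar> < \<epsilon>)"
  shows "h \<in> C_L x0"
proof (rule C_L_I[OF h])
  fix s and \<epsilon> :: real assume s: "asymptotically_sublinear s" and "\<epsilon> > 0"
  from ctl[OF this(2)] obtain G \<delta> where G: "finite G" "G \<subseteq> C_L x0" and "\<delta> > 0"
    and d: "\<forall>y z. (\<forall>g\<in>G. \<bar>g y - g z\<bar> < \<delta>) \<longrightarrow> \<bar>h y - h z\<bar> < \<epsilon>"
    by (elim exE conjE)
  have "\<forall>g\<in>G. \<exists>r0. \<forall>x y z. dist x x0 > r0 \<longrightarrow> y \<in> ball x (s (dist x x0)) \<longrightarrow>
           z \<in> ball x (s (dist x x0)) \<longrightarrow> \<bar>g y - g z\<bar> < \<delta>"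
    using C_L_oscillation[OF subsetD[OF G(2)] s \<open>\<delta> > 0\<close>] by (metis (no_types))
  from bchoice[OF this] obtain r where r: "\<forall>g\<in>G. \<forall>x y z. dist x x0 > r g \<longrightarrow>
      y \<in> ball x (s (dist x x0)) \<longrightarrow> z \<in> ball x (s (dist x x0)) \<longrightarrow> \<bar>g y - g z\<bar> < \<delta>"
    by (elim exE)
  define R where "R = Max (insert 1 (r ` G))"
  have R: "R \<ge> 1" "\<And>g. g \<in> G \<Longrightarrow> r g \<le> R"
    using G(1) by (auto simp: R_def)
  have "\<bar>h y - h z\<bar> < \<epsilon>"
    if x: "dist x x0 > R" and yz: "y \<in> ball x (s (dist x x0))" "z \<in> ball x (s (dist x x0))" for x y z
  proof -
    have "\<bar>g y - g z\<bar> < \<delta>" if "g \<in> G" for g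
    proof -
      have "dist x x0 > r g" using x R(2)[OF that] by linarith
      with r that yz show ?thesis by simp
    qed
    with d show ?thesis by simp
  qed
  then show "\<exists>r0>0. \<forall>x y z. dist x x0 > r0 \<longrightarrow> y \<in> ball x (s (dist x x0)) \<longrightarrow>
           z \<in> ball x (s (dist x x0)) \<longrightarrow> \<bar>h y - h z\<bar> < \<epsilon>"
    using R(1) by (intro exI[of _ R]) simp
qed

lemma C_L_bump:
  fixes x0 :: "'a::metric_space"
  assumes "r > 0"
  shows "(\<lambda>y. max 0 (1 - dist p y / r)) \<in> C_L x0"
proof (rule C_L_I)
  show "(\<lambda>y. max 0 (1 - dist p y / r)) \<in> bcontfun"
    by (rule bcontfunI_real[where B=1]) (use assms in \<open>auto intro!: continuous_intros\<close>)
  fix s and \<epsilon> :: real assume s: "asymptotically_sublinear s" and "\<epsilon> > 0"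
  from s have "\<exists>t0>0. \<forall>t>t0. s t < 1/2 * t"
    unfolding asymptotically_sublinear_def by (meson half_gt_zero zero_less_one)
  then obtain t0 where "t0 > 0" and t0: "\<And>t. t > t0 \<Longrightarrow> s t < 1/2 * t" by blast
  define R where "R = max t0 (2 * (r + dist p x0))"
  have far: "max 0 (1 - dist p y / r) = 0"
    if "dist x x0 > R" "y \<in> ball x (s (dist x x0))" for x y
  proof -
    have "dist x y < dist x x0 / 2" using that t0[of "dist x x0"] by (auto simp: R_def)
    moreover have "dist x x0 \<le> dist x y + dist p y + dist p x0"
      using dist_triangle[of x x0 y] dist_triangle[of y x0 p] by (simp add: dist_commute)
    ultimately have "dist p y \<ge> r" using that(1) by (auto simp: R_def)
    then show ?thesis using assms by simp
  qed
  have "R > 0" using \<open>t0 > 0\<close> by (simp add: R_def)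
  moreover have "\<bar>max 0 (1 - dist p y / r) - max 0 (1 - dist p z / r)\<bar> < \<epsilon>"
    if "dist x x0 > R" "y \<in> ball x (s (dist x x0))" "z \<in> ball x (s (dist x x0))" for x y z
    unfolding far[OF that(1,2)] far[OF that(1,3)] using \<open>\<epsilon> > 0\<close> by simp
  ultimately show "\<exists>r0>0. \<forall>x y z. dist x x0 > r0 \<longrightarrow> y \<in> ball x (s (dist x x0)) \<longrightarrow>
      z \<in> ball x (s (dist x x0)) \<longrightarrow>
      \<bar>max 0 (1 - dist p y / r) - max 0 (1 - dist p z / r)\<bar> < \<epsilon>"
    by blast
qed

lemma Hausdorff_space_fun_real: "Hausdorff_space (euclidean :: ('i \<Rightarrow> real) topology)"
  unfolding euclidean_product_topology[symmetric]
  by (simp add: Hausdorff_space_product_topology)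

lemma product_uniformly_continuous:
  fixes S :: "('i \<Rightarrow> real) set" and F :: "('i \<Rightarrow> real) \<Rightarrow> real"
  assumes S: "compact S" and F: "continuous_on S F" and "\<epsilon> > 0"
  obtains G \<delta> where "finite G" "\<delta> > 0"
    "\<And>v w. \<lbrakk>v \<in> S; w \<in> S; \<And>i. i \<in> G \<Longrightarrow> \<bar>v i - w i\<bar> < \<delta>\<rbrakk> \<Longrightarrow> \<bar>F v - F w\<bar> < \<epsilon>"
proof -
  have loc: "\<exists>G \<delta>. finite G \<and> \<delta> > 0 \<and>
      (\<forall>w\<in>S. (\<forall>i\<in>G. \<bar>w i - z i\<bar> < \<delta>) \<longrightarrow> \<bar>F w - F z\<bar> < \<epsilon>/2)" if "z \<in> S" for z
  proof -
    obtain T where T: "open T" "T \<inter> S = F -` ball (F z) (\<epsilon>/2) \<inter> S"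
      using F unfolding continuous_on_open_invariant by (metis open_ball)
    have "z \<in> T" using T(2) that \<open>\<epsilon> > 0\<close> by auto
    have "openin (product_topology (\<lambda>_. euclidean) UNIV) T"
      using T(1) by (simp add: euclidean_product_topology)
    from product_topology_open_contains_basis[OF this \<open>z \<in> T\<close>] obtain X
      where X: "z \<in> (\<Pi>\<^sub>E i\<in>UNIV. X i)" "\<And>i. open (X i)" "finite {i. X i \<noteq> UNIV}"
        "(\<Pi>\<^sub>E i\<in>UNIV. X i) \<subseteq> T"
      by auto
    have "\<exists>d>0. ball (z i) d \<subseteq> X i" for i
      using X(1,2) by (meson PiE_mem UNIV_I open_contains_ball)
    then obtain d where d: "\<And>i. d i > 0" "\<And>i. ball (z i) (d i) \<subseteq> X i" by metis
    let ?G = "{i. X i \<noteq> UNIV}"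
    define \<delta> where "\<delta> = Min (insert 1 (d ` ?G))"
    have \<delta>: "\<delta> > 0" "\<And>i. i \<in> ?G \<Longrightarrow> \<delta> \<le> d i"
      using X(3) d(1) by (auto simp: \<delta>_def)
    have "\<bar>F w - F z\<bar> < \<epsilon>/2" if "w \<in> S" "\<forall>i\<in>?G. \<bar>w i - z i\<bar> < \<delta>" for w
    proof -
      have "w i \<in> X i" for i
      proof (cases "i \<in> ?G")
        case True
        then have "w i \<in> ball (z i) (d i)"
        proof -
          have "\<bar>w i - z i\<bar> < d i" using that(2) \<delta>(2)[OF True] True by (meson less_le_trans)
          then show ?thesis by (simp add: dist_real_def abs_minus_commute)
        qed
        then show ?thesis using d(2) by blast
      qed auto
      then have "w \<in> T" using X(4) by (auto simp: PiE_def)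
      then have "w \<in> F -` ball (F z) (\<epsilon>/2)" using T(2) \<open>w \<in> S\<close> by blast
      then show ?thesis by (simp add: dist_real_def abs_minus_commute)
    qed
    with X(3) \<delta>(1) show ?thesis by (intro exI[of _ ?G] exI[of _ \<delta>]) simp
  qed
  from loc have "\<exists>p. finite (fst p) \<and> snd p > 0 \<and>
      (\<forall>w\<in>S. (\<forall>i\<in>fst p. \<bar>w i - z i\<bar> < snd p) \<longrightarrow> \<bar>F w - F z\<bar> < \<epsilon>/2)" if "z \<in> S" for z
    using that by (metis fst_conv snd_conv)
  then have "\<forall>z\<in>S. \<exists>p. finite (fst p) \<and> snd p > 0 \<and>
      (\<forall>w\<in>S. (\<forall>i\<in>fst p. \<bar>w i - z i\<bar> < snd p) \<longrightarrow> \<bar>F w - F z\<bar> < \<epsilon>/2)"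
    by blast
  from bchoice[OF this] obtain P where P: "\<forall>z\<in>S. finite (fst (P z)) \<and> snd (P z) > 0 \<and>
      (\<forall>w\<in>S. (\<forall>i\<in>fst (P z). \<bar>w i - z i\<bar> < snd (P z)) \<longrightarrow> \<bar>F w - F z\<bar> < \<epsilon>/2)"
    by blast
  define G \<delta> where "G z = fst (P z)" and "\<delta> z = snd (P z)" for z
  have G: "\<And>z. z \<in> S \<Longrightarrow> finite (G z)" and \<delta>: "\<And>z. z \<in> S \<Longrightarrow> \<delta> z > (0::real)"
    and l: "\<And>z w. \<lbrakk>z \<in> S; w \<in> S; \<forall>i\<in>G z. \<bar>w i - z i\<bar> < \<delta> z\<rbrakk> \<Longrightarrow> \<bar>F w - F z\<bar> < \<epsilon>/2"
    using P by (simp_all add: G_def \<delta>_def)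
  define N where "N z = (\<Inter>i\<in>G z. {w. \<bar>w i - z i\<bar> < \<delta> z / 2})" for z
  have proj: "continuous_on UNIV (\<lambda>w. w i :: real)" for i :: 'i
    by simp
  have N_open: "open (N z)" if "z \<in> S" for z
    unfolding N_def using G[OF that]
    by (intro open_INT ballI open_Collect_less continuous_intros proj) auto
  have "S \<subseteq> (\<Union>z\<in>S. N z)"
    using \<delta> by (auto simp: N_def)
  then obtain Z where Z: "Z \<subseteq> S" "finite Z" "S \<subseteq> (\<Union>z\<in>Z. N z)"
    using compactE_image[OF S, of S N] N_open by metis
  define D where "D = Min (insert 1 ((\<lambda>z. \<delta> z / 2) ` Z))"
  have D: "D > 0" "\<And>z. z \<in> Z \<Longrightarrow> D \<le> \<delta> z / 2"
  proof -
    show "D > 0" using Z(1,2) \<delta> by (auto simp: D_def)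
    show "D \<le> \<delta> z / 2" if "z \<in> Z" for z
      unfolding D_def using Z(2) that by (intro Min_le) auto
  qed
  show ?thesis
  proof
    show "finite (\<Union>z\<in>Z. G z)" using Z G by auto
    show "D > 0" by (rule D)
    fix v w assume vw: "v \<in> S" "w \<in> S" and close: "\<And>i. i \<in> (\<Union>z\<in>Z. G z) \<Longrightarrow> \<bar>v i - w i\<bar> < D"
    from vw(1) Z(3) obtain z where z: "z \<in> Z" "v \<in> N z" by blast
    then have "z \<in> S" using Z(1) by blast
    have v: "\<bar>v i - z i\<bar> < \<delta> z / 2" if "i \<in> G z" for i
      using z(2) that by (auto simp: N_def)
    have "\<bar>F v - F z\<bar> < \<epsilon>/2"
    proof (intro l \<open>z \<in> S\<close> vw ballI)
      fix i assume "i \<in> G z"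
      from v[OF this] \<delta>[OF \<open>z \<in> S\<close>] show "\<bar>v i - z i\<bar> < \<delta> z" by linarith
    qed
    moreover have "\<bar>w i - z i\<bar> < \<delta> z" if "i \<in> G z" for i
    proof -
      have "\<bar>v i - w i\<bar> < D" using that z(1) by (intro close) blast
      with v[OF that] D(2)[OF z(1)] show ?thesis by linarith
    qed
    then have "\<bar>F w - F z\<bar> < \<epsilon>/2"
      by (intro l \<open>z \<in> S\<close> vw) auto
    ultimately show "\<bar>F v - F w\<bar> < \<epsilon>" by linarith
  qed
qed

text \<open>
  The compactification associated with \<open>C_L x0\<close>: the closure of the image of the evaluation map
  in the product of copies of the real line. Coordinates not in \<open>C_L x0\<close> are set to 0.
\<close>

definition evaluation_C_L :: "'a::metric_space \<Rightarrow> 'a \<Rightarrow> (('a \<Rightarrow> real) \<Rightarrow> real)" where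
  "evaluation_C_L x0 x = (\<lambda>f. if f \<in> C_L x0 then f x else 0)"

definition hL :: "'a::metric_space \<Rightarrow> (('a \<Rightarrow> real) \<Rightarrow> real) topology" where
  "hL x0 = top_of_set (closure (range (evaluation_C_L x0)))"

theorem sublinear_Higson_compactification_exists:
  fixes x0 :: "'a::metric_space"
  shows "sublinear_Higson_compactification x0 (hL x0) (evaluation_C_L x0)"
proof -
  let ?e = "evaluation_C_L x0"
  let ?S = "closure (range ?e)"
  have e_cont: "continuous_on UNIV ?e"
    unfolding evaluation_C_L_def
  proof (rule continuous_on_coordinatewise_then_product)
    fix f show "continuous_on UNIV (\<lambda>x. if f \<in> C_L x0 then f x else 0)"
      using C_L_bcontfun[of f x0] by (cases "f \<in> C_L x0") (auto simp: bcontfun_def)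
  qed
  have proj: "continuous_on T (\<lambda>z. z f)" for T and f :: "'a \<Rightarrow> real"
    by (rule continuous_on_subset[OF continuous_on_product_coordinates]) auto
  have S_compact: "compact ?S"
  proof -
    have "\<exists>B. \<forall>x. \<bar>?e x f\<bar> \<le> B" for f
    proof (cases "f \<in> C_L x0")
      case True
      from bcontfun_bound[OF C_L_bcontfun[OF True]] obtain B where "\<And>x. \<bar>f x\<bar> \<le> B" by blast
      with True show ?thesis by (auto simp: evaluation_C_L_def)
    qed (auto simp: evaluation_C_L_def)
    then obtain b where b: "\<And>x f. \<bar>?e x f\<bar> \<le> b f" by metis
    have "compactin (product_topology (\<lambda>_. euclideanreal) UNIV) (PiE UNIV (\<lambda>f. {- b f..b f}))"
      by (simp add: compactin_PiE)
    then have c: "compact (PiE UNIV (\<lambda>f. {- b f..b f}))"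
      by (simp add: euclidean_product_topology)
    have "closed (\<Inter>f::'a \<Rightarrow> real. {z. - b f \<le> z f} \<inter> {z. z f \<le> b f})"
      by (intro closed_INT ballI closed_Int closed_Collect_le continuous_intros proj)
    moreover have "(\<Inter>f::'a \<Rightarrow> real. {z. - b f \<le> z f} \<inter> {z. z f \<le> b f}) = PiE UNIV (\<lambda>f. {- b f..b f})"
      by (auto simp: PiE_def)
    ultimately have cl: "closed (PiE UNIV (\<lambda>f. {- b f..b f}))" by simp
    have "range ?e \<subseteq> PiE UNIV (\<lambda>f. {- b f..b f})"
    proof clarify
      fix x
      have "?e x f \<in> {- b f..b f}" for f using b[of x f] by (simp add: abs_le_iff)
      then show "?e x \<in> PiE UNIV (\<lambda>f. {- b f..b f})" by (simp add: PiE_def)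
    qed
    then have "?S \<subseteq> PiE UNIV (\<lambda>f. {- b f..b f})"
      by (rule closure_minimal[OF _ cl])
    then have "PiE UNIV (\<lambda>f. {- b f..b f}) \<inter> ?S = ?S"
      by (rule Int_absorb1)
    with compact_Int_closed[OF c closed_closure, of "range ?e"] show ?thesis
      by (simp only:)
  qed
  have e_S: "?e x \<in> ?S" for x by (rule subsetD[OF closure_subset rangeI])
  have e_app: "?e x f = f x" if "f \<in> C_L x0" for x f using that by (simp add: evaluation_C_L_def)
  have inj: "inj ?e"
  proof (rule injI)
    fix x y assume eq: "?e x = ?e y"
    show "x = y"
    proof (rule ccontr)
      assume "x \<noteq> y"
      then have "dist x y > 0" by simp
      note f = C_L_bump[OF this, of x x0]
      from eq have "max 0 (1 - dist x x / dist x y) = max 0 (1 - dist x y / dist x y)"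
        using e_app[OF f, of x] e_app[OF f, of y] by (simp only:)
      with \<open>x \<noteq> y\<close> show False by simp
    qed
  qed
  have emb: "embedding_map euclidean (hL x0) ?e"
    unfolding embedding_map_def
  proof (rule bijective_open_imp_homeomorphic_map)
    have sub: "subtopology (hL x0) (?e ` topspace euclidean) = top_of_set (range ?e)"
      using closure_subset[of "range ?e"] by (simp add: hL_def subtopology_subtopology Int_absorb1)
    show "continuous_map euclidean (subtopology (hL x0) (?e ` topspace euclidean)) ?e"
      using e_cont unfolding sub by (simp add: continuous_map_in_subtopology)
    show "?e ` topspace euclidean = topspace (subtopology (hL x0) (?e ` topspace euclidean))"
      unfolding sub by simp
    show "inj_on ?e (topspace euclidean)" using inj by simp
    show "open_map euclidean (subtopology (hL x0) (?e ` topspace euclidean)) ?e"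
      unfolding sub open_map_def
    proof (intro allI impI)
      fix U :: "'a set" assume "openin euclidean U"
      then have "open U" by simp
      show "openin (top_of_set (range ?e)) (?e ` U)"
      proof (subst openin_subopen, intro ballI)
        fix z assume "z \<in> ?e ` U"
        then obtain p where p: "p \<in> U" "z = ?e p" by blast
        with \<open>open U\<close> obtain r where "r > 0" and r: "ball p r \<subseteq> U"
          by (meson open_contains_ball)
        define f where "f y = max 0 (1 - dist p y / r)" for y
        have f: "f \<in> C_L x0" using C_L_bump[OF \<open>r > 0\<close>] unfolding f_def .
        have fpos: "f y > 0 \<longleftrightarrow> y \<in> ball p r" for y
          using \<open>r > 0\<close> by (auto simp: f_def less_max_iff_disj)
        have "open {z. z f > (0::real)}"
          by (intro open_Collect_less continuous_intros proj)
        then have "openin (top_of_set (range ?e)) (range ?e \<inter> {z. z f > 0})"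
          by (rule openin_open_Int)
        moreover have "z \<in> range ?e \<inter> {z. z f > 0}"
          using p \<open>r > 0\<close> by (auto simp: e_app[OF f] fpos)
        moreover have "range ?e \<inter> {z. z f > 0} \<subseteq> ?e ` U"
          using r by (auto simp: e_app[OF f] fpos)
        ultimately show "\<exists>T. openin (top_of_set (range ?e)) T \<and> z \<in> T \<and> T \<subseteq> ?e ` U"
          by blast
      qed
    qed
  qed
  have comp: "compactification (hL x0) ?e"
    unfolding compactification_def
  proof (intro conjI emb)
    show "compact_space (hL x0)"
      using S_compact by (simp add: hL_def compact_space_subtopology)
    show "Hausdorff_space (hL x0)"
      unfolding hL_def by (intro Hausdorff_space_subtopology Hausdorff_space_fun_real)
    show "hL x0 closure_of range ?e = topspace (hL x0)"
      using closure_subset[of "range ?e"]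
      by (simp add: hL_def closure_of_subtopology Int_absorb1)
  qed
  have "extends_continuously (hL x0) ?e f" if "f \<in> C_L x0" for f
    unfolding extends_continuously_def hL_def
    by (intro exI[of _ "\<lambda>z. z f"]) (simp add: proj e_app[OF that])
  moreover have "f \<in> C_L x0" if f: "f \<in> bcontfun" and ext: "extends_continuously (hL x0) ?e f" for f
  proof -
    from ext obtain F where F: "continuous_on ?S F" and Fe: "\<And>x. F (?e x) = f x"
      unfolding extends_continuously_def hL_def by auto
    show ?thesis
    proof (rule C_L_control[OF f])
      fix \<epsilon> :: real assume "\<epsilon> > 0"
      obtain G \<delta> where G: "finite G" "\<delta> > 0"
        "\<And>v w. \<lbrakk>v \<in> ?S; w \<in> ?S; \<And>i. i \<in> G \<Longrightarrow> \<bar>v i - w i\<bar> < \<delta>\<rbrakk> \<Longrightarrow> \<bar>F v - F w\<bar> < \<epsilon>"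
        by (rule product_uniformly_continuous[OF S_compact F \<open>\<epsilon> > 0\<close>]) blast
      have "\<bar>f y - f z\<bar> < \<epsilon>" if close: "\<forall>g\<in>G \<inter> C_L x0. \<bar>g y - g z\<bar> < \<delta>" for y z
      proof -
        have "\<bar>?e y g - ?e z g\<bar> < \<delta>" if "g \<in> G" for g
          using close that \<open>\<delta> > 0\<close> by (auto simp: evaluation_C_L_def)
        then show ?thesis using G(3)[OF e_S e_S] by (simp add: Fe)
      qed
      with G(1,2) show "\<exists>G \<delta>. finite G \<and> G \<subseteq> C_L x0 \<and> \<delta> > 0 \<and>
          (\<forall>y z. (\<forall>g\<in>G. \<bar>g y - g z\<bar> < \<delta>) \<longrightarrow> \<bar>f y - f z\<bar> < \<epsilon>)"
        by (intro exI[of _ "G \<inter> C_L x0"] exI[of _ \<delta>]) auto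
    qed
  qed
  ultimately show ?thesis
    using comp unfolding sublinear_Higson_compactification_def by blast
qed

end

theory Submission
  imports Defs
begin

text \<open>
  The sublinear corona can be cut along spheres whose radii grow geometrically: a bounded Lipschitz function of
  $\log(1 + |x|)$ belongs to $C_L(X)$, because a step of length $o(|x|)$ changes
  $\log(1+|x|)$ only by $o(1)$.

  On the line, consider the translated integer lattice $\theta + \mathbb{Z}$ and pull the intervals
  $(\theta + k - 1/3, \theta + k + 1/3)$ back along $\log(1+|x|)$ to shells in $X$, indexed by $k$.
  The shells for $\theta = 0$ and those for $\theta = 1/2$ together cover $X$, so a given corona
  point $p$ has, for one of the two values of $\theta$, a neighbourhood in $h_L X$ whose trace on
  $X$ lies in the union of the shells. Let $U$ be an open connected neighbourhood of $p$ in the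
  corona inside it. Points of $X$ close to $p$ occur in shells of infinitely many indices, by
  properness; divide these indices into two infinite sets $A$ and $B$. The distance of
  $\log(1+|x|)$ to $\theta + A$ is less than $1/3$ on the shells with index in $A$ and greater than
  $2/3$ on all others, so its extension to $h_L X$ avoids the values between $1/3$ and $2/3$ on $U$.
  It takes values on both sides of the gap: points near $p$ in the shells of $A$ form an unbounded
  set and thus accumulate at a corona point, which lies in $U$, and so do points in the shells of
  $B$. This contradicts the connectedness of $U$.
\<close>

section \<open>Slowly varying functions of the radius\<close>

definition log_radius :: "'a::metric_space \<Rightarrow> 'a \<Rightarrow> real" where
  "log_radius x0 x = ln (1 + dist x x0)"

lemma log_radius_nonneg: "log_radius x0 x \<ge> 0"
  by (simp add: log_radius_def)

lemma continuous_log_radius: "continuous_on UNIV (log_radius x0)"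
  unfolding log_radius_def
  by (intro continuous_intros) (smt (verit) zero_le_dist)

text \<open>
  Write \<open>r\<close> for the distance of \<open>x\<close> from the base point. The radii of \<open>y\<close> and \<open>z\<close> are at least
  \<open>r / 2\<close>, where the derivative of the logarithm is at most \<open>2 / r\<close>, and they differ by at most
  \<open>2 * \<alpha> * r\<close>.
\<close>

lemma log_radius_close:
  fixes x0 :: "'a::metric_space"
  assumes "0 < \<alpha>" "\<alpha> \<le> 1/2" and x: "dist x x0 > 0"
    and y: "dist x y < \<alpha> * dist x x0" and z: "dist x z < \<alpha> * dist x x0"
  shows "\<bar>log_radius x0 y - log_radius x0 z\<bar> \<le> 4 * \<alpha>"
proof -
  define r where "r = dist x x0"
  have half: "\<alpha> * r \<le> r / 2" using assms(2) x by (simp add: r_def mult_right_mono)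
  have *: "log_radius x0 u - log_radius x0 v \<le> 4 * \<alpha>"
    if u: "dist x u < \<alpha> * r" and v: "dist x v < \<alpha> * r" for u v
  proof -
    define a b where "a = 1 + dist v x0" and "b = 1 + dist u x0"
    have "r \<le> dist x v + dist v x0" by (simp add: r_def dist_triangle)
    then have a: "a > r / 2" using v half by (simp add: a_def)
    have "dist u x0 \<le> dist x u + r" "r \<le> dist x v + dist v x0"
      using dist_triangle[of u x0 x] dist_triangle[of x x0 v] by (simp_all add: r_def dist_commute)
    then have ab: "b - a \<le> 2 * \<alpha> * r" using u v by (simp add: a_def b_def)
    have pos: "a > 0" "b > 0" by (simp_all add: a_def b_def add_pos_nonneg)
    have "ln b - ln a = ln (b / a)" using pos by (simp add: ln_div)
    also have "\<dots> \<le> b / a - 1" using pos by (intro ln_le_minus_one) simp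
    also have "\<dots> = (b - a) / a" using pos by (simp add: field_simps)
    also have "\<dots> \<le> 4 * \<alpha>"
    proof -
      have "4 * \<alpha> * (r / 2) \<le> 4 * \<alpha> * a" using a assms(1) by (intro mult_left_mono) auto
      then have "b - a \<le> 4 * \<alpha> * a" using ab by simp
      then show ?thesis using pos by (simp add: divide_le_eq)
    qed
    finally show ?thesis by (simp add: log_radius_def a_def b_def)
  qed
  show ?thesis
    using *[of y z] *[of z y] y z unfolding r_def by (simp add: abs_le_iff)
qed

text \<open>
  This is the source of all elements of $C_L(X)$ in the proof. A sublinear radius is eventually
  below \<open>\<alpha> * r\<close> for each fixed \<open>\<alpha>\<close>, so the oscillation is eventually at most \<open>4 * \<alpha>\<close>.
\<close>

lemma Lipschitz_log_radius_in_C_L: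
  fixes x0 :: "'a::metric_space" and \<phi> :: "real \<Rightarrow> real"
  assumes lip: "\<And>a b. \<bar>\<phi> a - \<phi> b\<bar> \<le> \<bar>a - b\<bar>" and bd: "\<And>a. \<bar>\<phi> a\<bar> \<le> B"
  shows "(\<lambda>x. \<phi> (log_radius x0 x)) \<in> C_L x0"
proof (rule C_L_I)
  have "1-lipschitz_on UNIV \<phi>"
    by (rule lipschitz_onI) (use lip in \<open>auto simp: dist_real_def\<close>)
  then have "continuous_on UNIV \<phi>" by (rule lipschitz_on_continuous_on)
  then have "continuous_on UNIV (\<lambda>x. \<phi> (log_radius x0 x))"
    by (rule continuous_on_compose2[OF _ continuous_log_radius]) simp
  then show "(\<lambda>x. \<phi> (log_radius x0 x)) \<in> bcontfun"
    by (rule bcontfunI_real[OF _ bd])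
  fix s and \<epsilon> :: real assume s: "asymptotically_sublinear s" and "\<epsilon> > 0"
  define \<alpha> where "\<alpha> = min (1/2) (\<epsilon>/5)"
  have \<alpha>: "\<alpha> > 0" "\<alpha> \<le> 1/2" "4 * \<alpha> < \<epsilon>" using \<open>\<epsilon> > 0\<close> by (auto simp: \<alpha>_def)
  with s obtain t0 where "t0 > 0" and t0: "\<And>t. t > t0 \<Longrightarrow> s t < \<alpha> * t"
    unfolding asymptotically_sublinear_def by blast
  have "\<bar>\<phi> (log_radius x0 y) - \<phi> (log_radius x0 z)\<bar> < \<epsilon>"
    if x: "dist x x0 > t0" and "y \<in> ball x (s (dist x x0))" "z \<in> ball x (s (dist x x0))" for x y z
  proof -
    have "dist x y < \<alpha> * dist x x0" "dist x z < \<alpha> * dist x x0"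
      using that t0[OF x] by auto
    then have "\<bar>log_radius x0 y - log_radius x0 z\<bar> \<le> 4 * \<alpha>"
      using x \<open>t0 > 0\<close> by (intro log_radius_close[OF \<alpha>(1,2)]) auto
    with lip[of "log_radius x0 y" "log_radius x0 z"] \<alpha>(3) show ?thesis by linarith
  qed
  with \<open>t0 > 0\<close> show "\<exists>r0>0. \<forall>x y z. dist x x0 > r0 \<longrightarrow> y \<in> ball x (s (dist x x0)) \<longrightarrow>
      z \<in> ball x (s (dist x x0)) \<longrightarrow>
      \<bar>\<phi> (log_radius x0 y) - \<phi> (log_radius x0 z)\<bar> < \<epsilon>"
    by blast
qed

section \<open>Logarithmic shells\<close>

text \<open>
  Truncation at 1 keeps the distance bounded and does not affect the comparison with the thresholds
  1/3 and 2/3.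
\<close>

definition lattice_dist :: "real \<Rightarrow> int set \<Rightarrow> real \<Rightarrow> real" where
  "lattice_dist \<theta> A t = min 1 (infdist t ((\<lambda>k. \<theta> + of_int k) ` A))"

lemma lattice_dist_Lipschitz: "\<bar>lattice_dist \<theta> A a - lattice_dist \<theta> A b\<bar> \<le> \<bar>a - b\<bar>"
  using infdist_triangle_abs[of a "(\<lambda>k. \<theta> + of_int k) ` A" b]
  by (auto simp: lattice_dist_def dist_real_def min_def)

lemma lattice_dist_bound: "\<bar>lattice_dist \<theta> A a\<bar> \<le> 1"
  using infdist_nonneg[of a "(\<lambda>k. \<theta> + of_int k) ` A"] by (auto simp: lattice_dist_def abs_if)

lemma lattice_dist_le: "k \<in> A \<Longrightarrow> lattice_dist \<theta> A t \<le> \<bar>t - \<theta> - of_int k\<bar>"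
  using infdist_le[of "\<theta> + of_int k" "(\<lambda>k. \<theta> + of_int k) ` A" t]
  by (auto simp: lattice_dist_def dist_real_def algebra_simps)

lemma le_lattice_dist:
  assumes "A \<noteq> {}" "c \<le> 1" "\<And>k. k \<in> A \<Longrightarrow> c \<le> \<bar>t - \<theta> - of_int k\<bar>"
  shows "c \<le> lattice_dist \<theta> A t"
proof -
  have "c \<le> infdist t ((\<lambda>k. \<theta> + of_int k) ` A)"
    using assms(1,3) unfolding infdist_def
    by (auto intro!: cINF_greatest simp: dist_real_def algebra_simps)
  with assms(2) show ?thesis by (simp add: lattice_dist_def)
qed

text \<open>Rounding picks a nearest lattice point.\<close>

lemma lattice_dist_UNIV_round: "\<bar>t - \<theta> - of_int (round (t - \<theta>))\<bar> \<le> lattice_dist \<theta> UNIV t"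
proof (rule le_lattice_dist)
  show "\<bar>t - \<theta> - of_int (round (t - \<theta>))\<bar> \<le> 1"
    using of_int_round_abs_le[of "t - \<theta>"] by linarith
qed (use round_diff_minimal[of "t - \<theta>"] in auto)

lemma lattice_dist_round_in:
  "\<lbrakk>lattice_dist \<theta> UNIV t \<le> c; round (t - \<theta>) \<in> A\<rbrakk> \<Longrightarrow> lattice_dist \<theta> A t \<le> c"
  using lattice_dist_le[of "round (t - \<theta>)" A \<theta> t] lattice_dist_UNIV_round[of t \<theta>] by linarith

text \<open>Distinct lattice points are at distance at least 1 from each other.\<close>

lemma lattice_dist_round_notin:
  assumes "A \<noteq> {}" "lattice_dist \<theta> UNIV t \<le> c" "0 \<le> c" "round (t - \<theta>) \<notin> A"
  shows "lattice_dist \<theta> A t \<ge> 1 - c"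
proof (rule le_lattice_dist[OF assms(1)])
  fix k assume "k \<in> A"
  with assms(4) have "round (t - \<theta>) \<noteq> k" by blast
  then have "\<bar>round (t - \<theta>) - k\<bar> \<ge> 1" by arith
  then have "\<bar>real_of_int (round (t - \<theta>)) - real_of_int k\<bar> \<ge> 1" by linarith
  with lattice_dist_UNIV_round[of t \<theta>] assms(2) show "1 - c \<le> \<bar>t - \<theta> - of_int k\<bar>" by linarith
qed (use assms(3) in simp)

text \<open>The two lattices together have spacing 1/2, so no point is farther than 1/4 from both.\<close>

lemma lattice_or_half_lattice_close:
  "lattice_dist 0 UNIV t \<le> 1/4 \<or> lattice_dist (1/2) UNIV t \<le> 1/4"
proof -
  define k where "k = round t"
  have "\<bar>t - of_int k\<bar> \<le> 1/2" using of_int_round_abs_le[of t] by (simp add: k_def abs_minus_commute)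
  then consider "\<bar>t - of_int k\<bar> \<le> 1/4" | "\<bar>t - 1/2 - of_int k\<bar> \<le> 1/4"
    | "\<bar>t - 1/2 - of_int (k - 1)\<bar> \<le> 1/4"
    unfolding of_int_diff of_int_1 by argo
  then show ?thesis
  proof cases
    case 1 then show ?thesis using lattice_dist_le[of k UNIV 0 t] by simp
  next
    case 2 then show ?thesis using lattice_dist_le[of k UNIV "1/2" t] by auto
  next
    case 3 then show ?thesis using lattice_dist_le[of "k - 1" UNIV "1/2" t] by auto
  qed
qed

abbreviation shell_dist :: "'a::metric_space \<Rightarrow> real \<Rightarrow> int set \<Rightarrow> 'a \<Rightarrow> real" where
  "shell_dist x0 \<theta> A \<equiv> \<lambda>x. lattice_dist \<theta> A (log_radius x0 x)"

definition shell_index :: "'a::metric_space \<Rightarrow> real \<Rightarrow> 'a \<Rightarrow> int" where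
  "shell_index x0 \<theta> x = round (log_radius x0 x - \<theta>)"

lemma shell_dist_in_C_L: "shell_dist x0 \<theta> A \<in> C_L x0"
  by (rule Lipschitz_log_radius_in_C_L[OF lattice_dist_Lipschitz lattice_dist_bound])

text \<open>
  The index is a rounded logarithm, so it lies in a fixed finite range exactly when the radius is
  bounded; the lower end of the range comes from the nonnegativity of the logarithm. This turns the
  choice of unbounded sets into the choice of infinite sets of integers.
\<close>

lemma bounded_iff_finite_shell_index:
  fixes E :: "'a::metric_space set"
  shows "bounded E \<longleftrightarrow> finite (shell_index x0 \<theta> ` E)"
proof
  assume "bounded E"
  then obtain R where R: "\<And>x. x \<in> E \<Longrightarrow> dist x x0 \<le> R"
    using bounded_any_center[of E x0] by (auto simp: dist_commute)
  have "shell_index x0 \<theta> x \<in> {round (- \<theta>)..round (ln (1 + R) - \<theta>)}" if "x \<in> E" for x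
  proof -
    have "log_radius x0 x \<le> ln (1 + R)"
      unfolding log_radius_def using R[OF that] by (intro ln_mono) (auto simp: add_pos_nonneg)
    with log_radius_nonneg[of x0 x] show ?thesis
      unfolding shell_index_def by (auto intro!: round_mono)
  qed
  then show "finite (shell_index x0 \<theta> ` E)"
    by (intro finite_subset[OF _ finite_atLeastAtMost_int]) blast
next
  assume fin: "finite (shell_index x0 \<theta> ` E)"
  define M where "M = real_of_int (Max (shell_index x0 \<theta> ` E)) + 1/2 + \<theta>"
  have "dist x0 x \<le> exp M" if "x \<in> E" for x
  proof -
    have "shell_index x0 \<theta> x \<le> Max (shell_index x0 \<theta> ` E)" using fin that by simp
    then have "log_radius x0 x \<le> M"
      using of_int_round_abs_le[of "log_radius x0 x - \<theta>"] unfolding shell_index_def M_def by linarith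
    then have "exp (log_radius x0 x) \<le> exp M" by simp
    moreover have "exp (log_radius x0 x) = 1 + dist x x0"
      unfolding log_radius_def by (rule exp_ln) (simp add: add_pos_nonneg)
    ultimately show ?thesis by (simp add: dist_commute)
  qed
  then show "bounded E" by (auto simp: bounded_def)
qed

section \<open>Unbounded sets and the corona\<close>

lemma compactification_imp_continuous:
  assumes "compactification K e" shows "continuous_map euclidean K e"
proof -
  have "homeomorphic_map euclidean (subtopology K (range e)) e"
    using assms by (simp add: compactification_def embedding_map_def)
  from homeomorphic_imp_continuous_map[OF this] show ?thesis
    by (simp only: continuous_map_in_subtopology)
qed

lemma bounded_subset_compact:
  fixes E :: "'a::metric_space set"
  assumes "proper_metric TYPE('a)" "bounded E"
  obtains C where "compact C" "E \<subseteq> C"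
proof -
  obtain x r where "E \<subseteq> cball x r" using assms(2) by (metis bounded_subset_cball)
  then have "E \<subseteq> cball x (max r 1)" by (auto simp: subset_eq)
  moreover have "compact (cball x (max r 1))" using assms(1) by (simp add: proper_metric_def)
  ultimately show ?thesis using that by blast
qed

text \<open>
  A bounded set lies in a compact one, whose image in the Hausdorff space \<open>K\<close> is closed and so has
  no accumulation points outside the range of \<open>e\<close>.
\<close>

lemma unbounded_near_corona_point:
  fixes e :: "'a::metric_space \<Rightarrow> 'b"
  assumes proper: "proper_metric TYPE('a)" and comp: "compactification K e"
    and p: "p \<in> topspace (corona K e)" and V: "openin K V" "p \<in> V"
  shows "\<not> bounded (e -` V)"
proof
  assume "bounded (e -` V)"
  from bounded_subset_compact[OF proper this] obtain C where C: "compact C" "e -` V \<subseteq> C" .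
  have K: "Hausdorff_space K" "K closure_of (range e) = topspace K"
    and cont: "continuous_map euclidean K e"
    using comp by (auto simp: compactification_def compactification_imp_continuous)
  have "closedin K (e ` C)"
    using image_compactin[OF _ cont, of C] C(1) compactin_imp_closedin[OF K(1)] by simp
  moreover have "p \<in> K closure_of (V \<inter> range e)"
    using openin_Int_closure_of_subset[OF V(1), of "range e"] V p K(2) openin_subset[OF V(1)] by auto
  moreover have "V \<inter> range e \<subseteq> e ` C" using C(2) by auto
  ultimately have "p \<in> e ` C" by (meson closure_of_minimal subsetD)
  with p show False by (auto simp: corona_def)
qed

text \<open>
  If all accumulation points were in the embedded space, the closure would be a compact subset of
  that space and hence bounded.
\<close>

lemma unbounded_accumulates_in_corona:
  fixes e :: "'a::metric_space \<Rightarrow> 'b"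
  assumes comp: "compactification K e" and E: "\<not> bounded E"
  obtains q where "q \<in> K closure_of (e ` E)" "q \<in> topspace (corona K e)"
proof -
  let ?C = "K closure_of (e ` E)"
  have emb: "embedding_map euclidean K e" and "compact_space K"
    using comp by (auto simp: compactification_def)
  have "\<not> ?C \<subseteq> range e"
  proof
    assume sub: "?C \<subseteq> range e"
    have top: "range e \<subseteq> topspace K"
      using continuous_map_image_subset_topspace[OF compactification_imp_continuous[OF comp]] by simp
    have "compactin K ?C" using \<open>compact_space K\<close> by (simp add: closedin_compact_space)
    then have "compactin (subtopology K (range e)) ?C"
      using sub by (simp add: compactin_subtopology)
    moreover have hom: "homeomorphic_map euclidean (subtopology K (range e)) e"
      using emb by (simp add: embedding_map_def)
    moreover have eq: "e ` (e -` ?C) = ?C" using sub by auto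
    ultimately have "compact (e -` ?C)"
      using homeomorphic_map_compactness[OF hom, of "e -` ?C"] by simp
    moreover have "E \<subseteq> e -` ?C" using closure_of_subset[of "e ` E" K] top by blast
    ultimately show False using E bounded_subset compact_imp_bounded by blast
  qed
  then obtain q where "q \<in> ?C" "q \<notin> range e" by blast
  then show ?thesis
    using that closure_of_subset_topspace[of K "e ` E"] by (auto simp: corona_def)
qed

lemma extension_value_in_closed:
  assumes F: "continuous_map K euclideanreal F" and "closed C"
    and q: "q \<in> K closure_of S" and S: "\<And>y. y \<in> S \<Longrightarrow> F y \<in> C"
  shows "F q \<in> C"
proof -
  have "F q \<in> F ` (K closure_of S)" using q by blast
  also have "\<dots> \<subseteq> closure (F ` S)"
    using continuous_map_image_closure_subset[OF F, of S] by simp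
  also have "\<dots> \<subseteq> C" using S \<open>closed C\<close> by (intro closure_minimal) auto
  finally show ?thesis .
qed

section \<open>Failure of local connectedness\<close>

text \<open>
  A corona point has a neighbourhood whose trace on the space lies in shells for one of the
  two lattices; the closed threshold 1/4 of the cover is relaxed to the open threshold 1/3.
\<close>

lemma corona_point_near_shells:
  fixes x0 :: "'a::metric_space" and e :: "'a \<Rightarrow> 'b"
  assumes "sublinear_Higson_compactification x0 K e" and p: "p \<in> topspace (corona K e)"
  obtains \<theta> W where "openin K W" "p \<in> W" "\<And>x. e x \<in> W \<Longrightarrow> shell_dist x0 \<theta> UNIV x < 1/3"
proof -
  have comp: "compactification K e"
    and ext: "\<And>f. f \<in> C_L x0 \<Longrightarrow> extends_continuously K e f"
    using assms(1) C_L_bcontfun unfolding sublinear_Higson_compactification_def by blast+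
  let ?V = "\<lambda>\<theta>. {x. shell_dist x0 \<theta> UNIV x \<le> 1/4}"
  have pK: "p \<in> topspace K" using p by (simp add: corona_def)
  have "UNIV = ?V 0 \<union> ?V (1/2)" using lattice_or_half_lattice_close by blast
  then have "range e = e ` ?V 0 \<union> e ` ?V (1/2)" by (metis image_Un)
  then have "p \<in> K closure_of (e ` ?V 0) \<union> K closure_of (e ` ?V (1/2))"
    using comp pK by (metis closure_of_Un compactification_def)
  then obtain \<theta> where \<theta>: "p \<in> K closure_of (e ` ?V \<theta>)" by blast
  from ext[OF shell_dist_in_C_L[where \<theta> = \<theta> and A = UNIV]] obtain F
    where F: "continuous_map K euclideanreal F" "\<And>x. F (e x) = shell_dist x0 \<theta> UNIV x"
    unfolding extends_continuously_def by blast
  have "F p \<in> {..1/4}" by (rule extension_value_in_closed[OF F(1) _ \<theta>]) (auto simp: F(2))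
  moreover have "openin K {z \<in> topspace K. F z \<in> {..<1/3}}"
    by (rule openin_continuous_map_preimage[OF F(1)]) simp
  ultimately show ?thesis
    using pK by (intro that[of "{z \<in> topspace K. F z \<in> {..<1/3}}" \<theta>]) (auto simp: F(2))
qed

theorem proposition3p1:
  fixes x0 :: "'a::metric_space"
    and K :: "'b topology"
    and e :: "'a \<Rightarrow> 'b"
  assumes "proper_metric TYPE('a)"
    and "\<not> compact (UNIV :: 'a set)"
    and "sublinear_Higson_compactification x0 K e"
  shows "\<forall>p \<in> topspace (corona K e). \<not> locally_connected_at p (corona K e)"
proof (intro ballI notI)
  fix p assume p: "p \<in> topspace (corona K e)" and lc: "locally_connected_at p (corona K e)"
  let ?Y = "topspace (corona K e)"
  have Y: "?Y = topspace K - range e" by (auto simp: corona_def)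
  have comp: "compactification K e"
    and ext: "\<And>f. f \<in> C_L x0 \<Longrightarrow> extends_continuously K e f"
    using assms(3) C_L_bcontfun unfolding sublinear_Higson_compactification_def by blast+
  have dense: "K closure_of range e = topspace K" and K: "compact_space K" "Hausdorff_space K"
    using comp by (auto simp: compactification_def)
  obtain \<theta> W where W: "openin K W" "p \<in> W" "\<And>x. e x \<in> W \<Longrightarrow> shell_dist x0 \<theta> UNIV x < 1/3"
    by (rule corona_point_near_shells[OF assms(3) p]) (rule that)
  have "openin (corona K e) (W \<inter> ?Y)"
    using W(1) openin_subset[OF W(1)] Y by (auto simp: corona_def openin_subtopology_Int)
  moreover have "p \<in> W \<inter> ?Y" using p W(2) by blast
  ultimately obtain U0 U where "p \<in> U0" "U0 \<subseteq> U" "U \<subseteq> W \<inter> ?Y"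
    and U: "openin (corona K e) U" "connectedin (corona K e) U"
    using lc unfolding locally_connected_at_def neighbourhood_base_at_def by meson
  then have U_p: "p \<in> U" and UW: "U \<subseteq> W" by blast+
  obtain U' where U': "openin K U'" "U = U' \<inter> ?Y"
    using U(1) Y unfolding corona_def openin_subtopology by auto
  \<comment> \<open>Regularity gives a closed neighbourhood \<open>D\<close> inside \<open>U'\<close>: corona points that are limits of
    points of the space in \<open>D\<close> then lie in \<open>U\<close>.\<close>
  have "neighbourhood_base_of (closedin K) K"
    using K by (simp add: neighbourhood_base_of_closedin compact_Hausdorff_imp_regular_space)
  then have base: "openin K S \<and> p \<in> S \<longrightarrow>
      (\<exists>V D. openin K V \<and> closedin K D \<and> p \<in> V \<and> V \<subseteq> D \<and> D \<subseteq> S)" for S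
    unfolding neighbourhood_base_of by (elim allE)
  have "openin K (U' \<inter> W)" "p \<in> U' \<inter> W" using U' W U_p by auto
  from base[THEN mp, OF conjI, OF this] obtain V D where V: "openin K V" "closedin K D" "p \<in> V" "V \<subseteq> D" "D \<subseteq> U' \<inter> W"
    by (elim exE conjE)
  let ?N = "shell_index x0 \<theta> ` (e -` V)"
  have "infinite ?N"
    using unbounded_near_corona_point[OF assms(1) comp p V(1,3)]
    by (simp add: bounded_iff_finite_shell_index[of _ x0 \<theta>])
  then obtain A B where AB: "A \<subseteq> ?N" "B \<subseteq> ?N" "infinite A" "infinite B" "A \<inter> B = {}"
    by (rule infinite_split)
  have "A \<noteq> {}" using AB(3) by auto
  from ext[OF shell_dist_in_C_L[where \<theta> = \<theta> and A = A]] obtain F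
    where F: "continuous_map K euclideanreal F" "\<And>x. F (e x) = shell_dist x0 \<theta> A x"
    unfolding extends_continuously_def by blast
  have F_in: "F (e x) \<le> 1/3" if "e x \<in> W" "shell_index x0 \<theta> x \<in> A" for x
    using lattice_dist_round_in[of \<theta> "log_radius x0 x" "1/3" A] W(3)[OF that(1)] that(2)
    by (simp add: F(2) shell_index_def)
  have F_notin: "F (e x) \<ge> 2/3" if "e x \<in> W" "shell_index x0 \<theta> x \<notin> A" for x
    using lattice_dist_round_notin[OF \<open>A \<noteq> {}\<close>, of \<theta> "log_radius x0 x" "1/3"] W(3)[OF that(1)] that(2)
    by (simp add: F(2) shell_index_def)
  \<comment> \<open>Both inequalities are closed conditions, so they pass from the trace of \<open>W\<close> on the space
    to \<open>U\<close> by density.\<close>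
  have gap: "F q \<in> {..1/3} \<union> {2/3..}" if "q \<in> U" for q
  proof (rule extension_value_in_closed[OF F(1)])
    have "q \<in> topspace K" "q \<in> W" using that UW U' Y by auto
    then show "q \<in> K closure_of (W \<inter> range e)"
      using openin_Int_closure_of_subset[OF W(1), of "range e"] dense by blast
    show "F y \<in> {..1/3} \<union> {2/3..}" if "y \<in> W \<inter> range e" for y
      using that F_in F_notin by auto
  qed auto
  have accumulate: "\<exists>q\<in>U. q \<in> K closure_of (e ` {x. e x \<in> V \<and> shell_index x0 \<theta> x \<in> J})"
    if J: "J \<subseteq> ?N" "infinite J" for J
  proof -
    let ?E = "{x. e x \<in> V \<and> shell_index x0 \<theta> x \<in> J}"
    have "shell_index x0 \<theta> ` ?E = J" using J(1) by auto
    with J(2) have "\<not> bounded ?E" by (simp add: bounded_iff_finite_shell_index[of _ x0 \<theta>])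
    from unbounded_accumulates_in_corona[OF comp this] obtain q
      where q: "q \<in> K closure_of (e ` ?E)" "q \<in> ?Y" .
    have "K closure_of (e ` ?E) \<subseteq> D" using V(2,4) by (intro closure_of_minimal) auto
    with q V(5) U'(2) show ?thesis by blast
  qed
  have VW: "V \<subseteq> W" using V(4,5) by blast
  obtain a where a: "a \<in> U" "a \<in> K closure_of (e ` {x. e x \<in> V \<and> shell_index x0 \<theta> x \<in> A})"
    using accumulate[OF AB(1,3)] by blast
  obtain b where b: "b \<in> U" "b \<in> K closure_of (e ` {x. e x \<in> V \<and> shell_index x0 \<theta> x \<in> B})"
    using accumulate[OF AB(2,4)] by blast
  have Fa: "F a \<in> {..1/3}"
    by (rule extension_value_in_closed[OF F(1) _ a(2)]) (use VW F_in in auto)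
  have Fb: "F b \<in> {2/3..}"
    by (rule extension_value_in_closed[OF F(1) _ b(2)]) (use VW F_notin AB(5) in auto)
  have "connectedin K U" using U(2) by (simp add: corona_def connectedin_subtopology)
  then have "connected (F ` U)" using connectedin_continuous_map_image[OF F(1)] by fastforce
  then have "1/2 \<in> F ` U"
    using connectedD_interval[of "F ` U" "F a" "F b" "1/2"] a(1) b(1) Fa Fb by auto
  with gap show False by force
qed

end
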